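(* The geodesics $\omega(t)=(X^1(t),X^2(t))$ of the Finsler band model $(\mathbb{B},F_B)$ satisfy $$4e^{X^1(t)}\sin X^2(t)=\pm\Big[m\big(4-e^{2X^1(t)}\big)+c\big(4+e^{2X^1(t)}\big)\Big],$$ where $m$ and $c$ are arbitrary real numbers.
   Context: Superscripts on $x$, $v$ and $X$ denote coordinates (so $x=(x^1,x^2)$, $v=(v^1,v^2)$), and $|\cdot|$ is the Euclidean norm. The band is $\mathbb{B}=\{(x^1,x^2)\in\mathbb{R}^2:-\frac{\pi}{2}<x^2<\frac{\pi}{2}\}$, and the Finsler band model is $\mathbb{B}$ with the Randers metric $$F_B(x,v)=\frac{|v|}{\cos x^2}+\frac{(e^{2x^1}-4)\,v^1\cos x^2+(e^{2x^1}+4)\,v^2\sin x^2}{(e^{2x^1}+4)\cos x^2},\qquad x\in\mathbb{B},\ v\in T_x\mathbb{B}\cong\mathbb{R}^2.$$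
   Formalization: The equation is proved for geodesics whose coordinate X^1 is not constant; the vertical geodesics X^1 = a are excluded, since along them sin X^2 takes infinitely many values while the right side takes at most two, so they satisfy the equation for no real m and c. *)

theory Defs
  imports "HOL-Analysis.Analysis"
begin

definition partial_pos ::
    "(real ^ 'n \<Rightarrow> real ^ 'n \<Rightarrow> real) \<Rightarrow> 'n \<Rightarrow> real ^ 'n \<Rightarrow> real ^ 'n \<Rightarrow> real" where
  "partial_pos L i x v = deriv (\<lambda>h. L (x + h *\<^sub>R axis i 1) v) 0"

definition partial_vel ::
    "(real ^ 'n \<Rightarrow> real ^ 'n \<Rightarrow> real) \<Rightarrow> 'n \<Rightarrow> real ^ 'n \<Rightarrow> real ^ 'n \<Rightarrow> real" where
  "partial_vel L i x v = deriv (\<lambda>h. L x (v + h *\<^sub>R axis i 1)) 0"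

definition finsler_energy ::
    "(real ^ 'n \<Rightarrow> real ^ 'n \<Rightarrow> real) \<Rightarrow> real ^ 'n \<Rightarrow> real ^ 'n \<Rightarrow> real" where
  "finsler_energy F x v = (F x v)\<^sup>2 / 2"

text \<open>
  A geodesic of a Finsler metric \<open>F\<close> on an open set \<open>U\<close> is a regular extremal of the energy
  functional, that is, a solution on an open interval of the Euler--Lagrange equations
  \<open>d/dt (\<partial>E/\<partial>v\<^sup>i) (\<omega>, \<omega>') = (\<partial>E/\<partial>x\<^sup>i) (\<omega>, \<omega>')\<close> with \<open>E = F\<^sup>2/2\<close>. Carrying out the time derivative
  and multiplying by the inverse of the fundamental tensor gives the spray form
  \<open>\<omega>''\<^sup>i + 2 G\<^sup>i (\<omega>, \<omega>') = 0\<close>. Such curves have constant \<open>F\<close>-speed. The velocity must not vanish,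
  since \<open>E\<close> is not smooth on the zero section.
\<close>

definition finsler_geodesic ::
    "(real ^ 'n) set \<Rightarrow> (real ^ 'n \<Rightarrow> real ^ 'n \<Rightarrow> real) \<Rightarrow> real set \<Rightarrow> (real \<Rightarrow> real ^ 'n) \<Rightarrow> bool" where
  "finsler_geodesic U F I \<omega> \<longleftrightarrow>
     open I \<and> is_interval I \<and> I \<noteq> {} \<and> \<omega> ` I \<subseteq> U \<and>
     \<omega> differentiable_on I \<and>
     (\<lambda>t. vector_derivative \<omega> (at t)) differentiable_on I \<and>
     (\<forall>t\<in>I. vector_derivative \<omega> (at t) \<noteq> 0) \<and>
     (\<forall>t\<in>I. \<forall>i.
        ((\<lambda>s. partial_vel (finsler_energy F) i (\<omega> s) (vector_derivative \<omega> (at s)))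
          has_real_derivative
          partial_pos (finsler_energy F) i (\<omega> t) (vector_derivative \<omega> (at t))) (at t))"

definition band :: "(real ^ 2) set" where
  "band = {x. - (pi / 2) < x $ 2 \<and> x $ 2 < pi / 2}"

definition F_band :: "real ^ 2 \<Rightarrow> real ^ 2 \<Rightarrow> real" where
  "F_band x v =
     norm v / cos (x $ 2) +
     ((exp (2 * x $ 1) - 4) * v $ 1 * cos (x $ 2) + (exp (2 * x $ 1) + 4) * v $ 2 * sin (x $ 2))
       / ((exp (2 * x $ 1) + 4) * cos (x $ 2))"

end

theory Submission
  imports Defs
begin

text \<open>
  Write \<open>(x, y)\<close> for the point and \<open>(a, b)\<close> for the velocity, and \<open>n\<close> for the Euclidean norm of
  \<open>(a, b)\<close>. The metric is the hyperbolic metric \<open>n / cos y\<close> plus a closed one-form, so its geodesics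
  have the same traces as hyperbolic ones and only their parametrisation (constant \<open>F\<close>-speed)
  differs. The hyperbolic momenta satisfy \<open>q\<^sub>1' = 0\<close> and \<open>q\<^sub>2' = n sin y / cos\<^sup>2 y\<close>, whence along a
  non-vertical geodesic \<open>r = cos y \<cdot> q\<^sub>2 / q\<^sub>1\<close> has \<open>r' = a sin y\<close>, and both
  \<open>exp (- x) (sin y + r)\<close> and \<open>exp x (sin y - r)\<close> are constant. Eliminating \<open>r\<close> gives
  \<open>sin y = P exp x + Q exp (- x)\<close>, which is the asserted curve.
\<close>

section \<open>Coordinate form and positivity of the metric\<close>

text \<open>This function is tanh (x - ln 2). It is the dx coefficient of the one-form in the
  metric, whose dy coefficient is \<open>tan y\<close>; each coefficient depends on its own variable
  only, so the form is closed.\<close>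

definition randers_drift :: "real \<Rightarrow> real" where
  "randers_drift x = (exp (2 * x) - 4) / (exp (2 * x) + 4)"

definition randers :: "real \<Rightarrow> real \<Rightarrow> real \<Rightarrow> real \<Rightarrow> real" where
  "randers x y a b =
     (sqrt (a\<^sup>2 + b\<^sup>2) + randers_drift x * a * cos y + b * sin y) / cos y"

text \<open>Where \<open>cos (x $ 2)\<close> vanishes, both sides are 0 by the convention for
  division, so the passage to scalar coordinates carries no side condition.\<close>

lemma F_band_eq: "F_band x v = randers (x $ 1) (x $ 2) (v $ 1) (v $ 2)"
proof -
  have E: "exp (2 * x $ 1) + 4 \<noteq> 0"
    using exp_gt_zero[of "2 * x $ 1"] by linarith
  have n: "norm v = sqrt ((v $ 1)\<^sup>2 + (v $ 2)\<^sup>2)"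
    by (simp add: norm_vec_def L2_set_def sum_2)
  show ?thesis
  proof (cases "cos (x $ 2) = 0")
    case True
    then show ?thesis by (simp add: F_band_def randers_def)
  next
    case False
    with E show ?thesis
      unfolding F_band_def randers_def randers_drift_def n
      by (simp add: divide_simps)
  qed
qed

text \<open>The square root scales by the absolute value of the factor and the one-form by the
  factor itself, hence the restriction to positive factors. This later normalises a tangent vector
  to Finsler length 1.\<close>

lemma randers_scale: "c > 0 \<Longrightarrow> randers x y (c * a) (c * b) = c * randers x y a b"
proof -
  assume c: "c > 0"
  have "(c * a)\<^sup>2 + (c * b)\<^sup>2 = c\<^sup>2 * (a\<^sup>2 + b\<^sup>2)" by algebra
  then have "sqrt ((c * a)\<^sup>2 + (c * b)\<^sup>2) = c * sqrt (a\<^sup>2 + b\<^sup>2)"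
    using c by (simp add: real_sqrt_mult)
  then show ?thesis by (simp add: randers_def algebra_simps)
qed

lemma randers_drift_sq_less_1: "(randers_drift x)\<^sup>2 < 1"
proof -
  have "exp (2 * x) + 4 > 0" "exp (2 * x) > 0"
    using exp_gt_zero[of "2 * x"] by linarith+
  then have "\<bar>randers_drift x\<bar> < 1"
    unfolding randers_drift_def by (auto simp: abs_less_iff field_simps)
  then show ?thesis by (simp add: abs_square_less_1)
qed

text \<open>By Cauchy-Schwarz the linear part is bounded by the Euclidean norm of
  \<open>(a, b)\<close> times that of the pair (drift * cos y, sin y). The latter is below 1 because
  the drift has absolute value below 1 and \<open>cos y > 0\<close>.\<close>

lemma randers_pos:
  assumes "cos y > 0" and ab: "a \<noteq> 0 \<or> b \<noteq> 0"
  shows "randers x y a b > 0"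
proof -
  let ?d = "randers_drift x" and ?c = "cos y" and ?s = "sin y"
  have ab': "a\<^sup>2 + b\<^sup>2 > 0" using ab by (simp add: sum_power2_gt_zero_iff)
  have "(?d * a * ?c + b * ?s)\<^sup>2 \<le> ((?d * ?c)\<^sup>2 + ?s\<^sup>2) * (a\<^sup>2 + b\<^sup>2)"
  proof -
    \<comment> \<open>Lagrange's identity exhibits the defect in Cauchy-Schwarz as a square.\<close>
    have "((?d * ?c)\<^sup>2 + ?s\<^sup>2) * (a\<^sup>2 + b\<^sup>2) - (?d * a * ?c + b * ?s)\<^sup>2
      = (?d * ?c * b - ?s * a)\<^sup>2" by algebra
    then show ?thesis by (smt (verit) zero_le_power2)
  qed
  also have "\<dots> < 1 * (a\<^sup>2 + b\<^sup>2)"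
  proof (rule mult_strict_right_mono[OF _ ab'])
    have "?d\<^sup>2 * ?c\<^sup>2 < 1 * ?c\<^sup>2"
      using randers_drift_sq_less_1 assms(1) by (intro mult_strict_right_mono) auto
    then show "(?d * ?c)\<^sup>2 + ?s\<^sup>2 < 1"
      using sin_cos_squared_add[of y] unfolding power_mult_distrib by linarith
  qed
  finally have "\<bar>?d * a * ?c + b * ?s\<bar> < sqrt (a\<^sup>2 + b\<^sup>2)"
    by (simp add: real_less_rsqrt)
  then show ?thesis using assms(1) by (simp add: randers_def)
qed

section \<open>Derivatives of the metric and of its energy\<close>

lemma has_real_derivative_randers_drift:
  "(randers_drift has_real_derivative 16 * exp (2 * x) / (exp (2 * x) + 4)\<^sup>2) (at x)"
proof -
  have E: "exp (2 * x) + 4 \<noteq> 0"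
    using exp_gt_zero[of "2 * x"] by linarith
  have "((\<lambda>x. (exp (2 * x) - 4) / (exp (2 * x) + 4)) has_real_derivative
     16 * exp (2 * x) / (exp (2 * x) + 4)\<^sup>2) (at x)"
    by (rule derivative_eq_intros refl | fact)+ (simp add: power2_eq_square algebra_simps)
  then show ?thesis by (simp add: randers_drift_def[abs_def])
qed

definition randers_dx :: "real \<Rightarrow> real \<Rightarrow> real" where
  "randers_dx x a = 16 * exp (2 * x) / (exp (2 * x) + 4)\<^sup>2 * a"

definition randers_dy :: "real \<Rightarrow> real \<Rightarrow> real \<Rightarrow> real" where
  "randers_dy y a b = (sqrt (a\<^sup>2 + b\<^sup>2) * sin y + b) / (cos y)\<^sup>2"

text \<open>With \<open>w\<close> equal to \<open>a\<close> or \<open>b\<close> this is the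
  corresponding velocity derivative of \<open>sqrt (a\<^sup>2 + b\<^sup>2) / cos y\<close>, the
  hyperbolic metric of the band.\<close>

definition hyp_momentum :: "real \<Rightarrow> real \<Rightarrow> real \<Rightarrow> real \<Rightarrow> real" where
  "hyp_momentum y a b w = w / (sqrt (a\<^sup>2 + b\<^sup>2) * cos y)"

text \<open>The left side is the raw output of the quotient rule, with \<open>n\<close>,
  \<open>c\<close>, \<open>s\<close>, \<open>d\<close> standing for norm, cosine, sine and drift.
  The right side sorts it by the derivatives of the four arguments, \<open>d'\<close> carrying that
  of the first.\<close>

lemma randers_quotient_rule:
  fixes n c s :: real
  assumes "n \<noteq> 0" "c \<noteq> 0" "s * s = 1 - c * c"
  shows "(((a * a' + b * b') / n + ((d' * a + a' * d) * c + (- s * y') * (d * a))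
             + (b' * s + c * y' * b)) * c - (n + d * a * c + b * s) * (- s * y')) / (c * c)
       = d' * a + (n * s + b) / c\<^sup>2 * y' + (a / (n * c) + d) * a' + (b / (n * c) + s / c) * b'"
    (is "?N / _ = _")
proof -
  \<comment> \<open>The drift terms in \<open>y'\<close> cancel, and \<open>b * y'\<close> is left
    with the factor \<open>c * c + s * s\<close>, which is 1.\<close>
  have "?N = (d' * a + (a / (n * c) + d) * a' + (b / (n * c) + s / c) * b') * (c * c)
        + (n * s + b * (c * c + s * s)) * y'"
    using assms(1,2) by (simp add: field_simps)
  then show ?thesis
    using assms(2,3) by (simp only:) (simp add: add_divide_distrib power2_eq_square algebra_simps)
qed

text \<open>The chain rule along an arbitrary curve of points and vectors. Coordinate lines give the
  partial derivatives, a geodesic gives the derivative of its speed, and a graph over the first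
  coordinate gives the regularity of its length element.\<close>

lemma has_real_derivative_randers:
  assumes X: "(X has_real_derivative X') (at t)" and Y: "(Y has_real_derivative Y') (at t)"
    and A: "(A has_real_derivative A') (at t)" and B: "(B has_real_derivative B') (at t)"
    and c: "cos (Y t) \<noteq> 0" and ab: "A t \<noteq> 0 \<or> B t \<noteq> 0"
  shows "((\<lambda>s. randers (X s) (Y s) (A s) (B s)) has_real_derivative
     randers_dx (X t) (A t) * X' + randers_dy (Y t) (A t) (B t) * Y'
     + (hyp_momentum (Y t) (A t) (B t) (A t) + randers_drift (X t)) * A'
     + (hyp_momentum (Y t) (A t) (B t) (B t) + tan (Y t)) * B') (at t)"
proof -
  have ab': "(A t)\<^sup>2 + (B t)\<^sup>2 > 0" using ab by (simp add: sum_power2_gt_zero_iff)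
  define n where "n = sqrt ((A t)\<^sup>2 + (B t)\<^sup>2)"
  have n: "n > 0" using ab' by (simp add: n_def)
  have "((\<lambda>s. (A s)\<^sup>2 + (B s)\<^sup>2) has_real_derivative 2 * (A t * A' + B t * B')) (at t)"
    by (rule derivative_eq_intros A B refl)+ (simp add: algebra_simps)
  from DERIV_chain2[OF DERIV_real_sqrt[OF ab'] this]
  have S: "((\<lambda>s. sqrt ((A s)\<^sup>2 + (B s)\<^sup>2)) has_real_derivative (A t * A' + B t * B') / n) (at t)"
    by (rule DERIV_cong) (simp add: n_def divide_simps)
  define d' where "d' = 16 * exp (2 * X t) / (exp (2 * X t) + 4)\<^sup>2 * X'"
  have D: "((\<lambda>s. randers_drift (X s)) has_real_derivative d') (at t)"
    unfolding d'_def by (rule DERIV_chain2[OF has_real_derivative_randers_drift X])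
  have sc: "sin (Y t) * sin (Y t) = 1 - cos (Y t) * cos (Y t)"
    using sin_squared_eq[of "Y t"] by (simp add: power2_eq_square)
  have cY: "((\<lambda>s. cos (Y s)) has_real_derivative - sin (Y t) * Y') (at t)"
    and sY: "((\<lambda>s. sin (Y s)) has_real_derivative cos (Y t) * Y') (at t)"
    using DERIV_chain2[OF DERIV_cos Y] DERIV_chain2[OF DERIV_sin Y] by simp_all
  have "((\<lambda>s. randers (X s) (Y s) (A s) (B s)) has_real_derivative
     (((A t * A' + B t * B') / n + ((d' * A t + A' * randers_drift (X t)) * cos (Y t)
       + - sin (Y t) * Y' * (randers_drift (X t) * A t)) + (B' * sin (Y t) + cos (Y t) * Y' * B t))
       * cos (Y t) - (n + randers_drift (X t) * A t * cos (Y t) + B t * sin (Y t))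
       * (- sin (Y t) * Y')) / (cos (Y t) * cos (Y t))) (at t)"
    unfolding randers_def
    by (rule DERIV_cong[OF DERIV_divide[OF DERIV_add[OF DERIV_add[OF S
            DERIV_mult[OF DERIV_mult[OF D A] cY]] DERIV_mult[OF B sY]] cY c]])
      (simp add: n_def)
  moreover have "randers_dx (X t) (A t) * X' = d' * A t"
    by (simp add: d'_def randers_dx_def)
  ultimately show ?thesis
    using n c sc ab
    by (subst (asm) randers_quotient_rule)
      (simp_all add: randers_dy_def hyp_momentum_def n_def tan_def d'_def randers_dx_def mult_ac)
qed

lemma axis_2_nth [simp]:
  "(axis 1 1 :: real ^ 2) $ 1 = 1" "(axis 1 1 :: real ^ 2) $ 2 = 0"
  "(axis 2 1 :: real ^ 2) $ 1 = 0" "(axis 2 1 :: real ^ 2) $ 2 = 1"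
  by (simp_all add: axis_def)

lemma has_real_derivative_half_square:
  assumes "(f has_real_derivative f') (at t)"
  shows "((\<lambda>s. (f s)\<^sup>2 / 2) has_real_derivative f t * f') (at t)"
  by (rule DERIV_cong[OF DERIV_cdivide[OF DERIV_power[OF assms, of 2], of 2]]) simp

text \<open>Each partial derivative is the chain rule for \<open>randers\<close> with three of the
  four arguments constant; halving the square leaves the factor \<open>F_band x v\<close>.\<close>

lemma band_energy_partials:
  assumes "cos (x $ 2) \<noteq> 0" and "v \<noteq> 0"
  shows "partial_pos (finsler_energy F_band) 1 x v = F_band x v * randers_dx (x $ 1) (v $ 1)"
    and "partial_pos (finsler_energy F_band) 2 x v =
      F_band x v * randers_dy (x $ 2) (v $ 1) (v $ 2)"
    and "partial_vel (finsler_energy F_band) 1 x v =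
      F_band x v * (hyp_momentum (x $ 2) (v $ 1) (v $ 2) (v $ 1) + randers_drift (x $ 1))"
    and "partial_vel (finsler_energy F_band) 2 x v =
      F_band x v * (hyp_momentum (x $ 2) (v $ 1) (v $ 2) (v $ 2) + tan (x $ 2))"
proof -
  have v: "v $ 1 \<noteq> 0 \<or> v $ 2 \<noteq> 0" using assms(2) by (auto simp: vec_eq_iff forall_2)
  have shift: "((\<lambda>h. w + h) has_real_derivative 1) (at 0)" for w :: real
    by (auto intro!: derivative_eq_intros)
  note rules = DERIV_imp_deriv DERIV_cong[OF has_real_derivative_half_square[OF
        has_real_derivative_randers]] DERIV_const shift
  show "partial_pos (finsler_energy F_band) 1 x v = F_band x v * randers_dx (x $ 1) (v $ 1)"
    unfolding partial_pos_def finsler_energy_def F_band_eq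
    by (simp, (rule rules)+) (use assms v in auto)
  show "partial_pos (finsler_energy F_band) 2 x v =
      F_band x v * randers_dy (x $ 2) (v $ 1) (v $ 2)"
    unfolding partial_pos_def finsler_energy_def F_band_eq
    by (simp, (rule rules)+) (use assms v in auto)
  show "partial_vel (finsler_energy F_band) 1 x v =
      F_band x v * (hyp_momentum (x $ 2) (v $ 1) (v $ 2) (v $ 1) + randers_drift (x $ 1))"
    unfolding partial_vel_def finsler_energy_def F_band_eq
    by (simp, (rule rules)+) (use assms v in auto)
  show "partial_vel (finsler_energy F_band) 2 x v =
      F_band x v * (hyp_momentum (x $ 2) (v $ 1) (v $ 2) (v $ 2) + tan (x $ 2))"
    unfolding partial_vel_def finsler_energy_def F_band_eq
    by (simp, (rule rules)+) (use assms v in auto)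
qed

section \<open>Separation of variables for an autonomous equation\<close>

lemma autonomous_ode_local_solution:
  fixes h :: "real \<Rightarrow> real"
  assumes "a < x0" "x0 < b" and h: "continuous_on {a..b} h"
    and pos: "\<And>x. x \<in> {a..b} \<Longrightarrow> h x > 0"
  obtains J x where "open J" "is_interval J" "0 \<in> J" "x 0 = x0"
    "\<And>t. t \<in> J \<Longrightarrow> x t \<in> {a<..<b}"
    "\<And>t. t \<in> J \<Longrightarrow> (x has_real_derivative 1 / h (x t)) (at t)"
proof -
  obtain H where H: "\<And>x. x \<in> {a..b} \<Longrightarrow> (H has_real_derivative h x) (at x within {a..b})"
    using antiderivative_continuous[OF h]
    unfolding has_real_derivative_iff_has_vector_derivative by blast
  \<comment> \<open>\<open>S x\<close> is the signed time at which the solution reaches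
    \<open>x\<close>, starting from \<open>x0\<close> at time 0. The solution is its inverse, on the
    image of the open interval.\<close>
  define S where "S x = H x - H x0" for x
  have SD: "(S has_real_derivative h x) (at x within {a..b})" if "x \<in> {a..b}" for x
    unfolding S_def using DERIV_diff[OF H[OF that] DERIV_const] by simp
  have SD': "(S has_real_derivative h x) (at x)" if "x \<in> {a<..<b}" for x
    using SD[of x] that by (simp add: at_within_Icc_at)
  have Sc: "continuous_on {a..b} S"
    unfolding continuous_on_eq_continuous_within using SD DERIV_continuous by blast
  have mono: "S u < S v" if "a \<le> u" "u < v" "v \<le> b" for u v
  proof (rule DERIV_pos_imp_increasing_open[OF that(2)])
    show "\<exists>D. (S has_real_derivative D) (at w) \<and> 0 < D" if "u < w" "w < v" for w
      using SD'[of w] pos[of w] that \<open>a \<le> u\<close> \<open>v \<le> b\<close> by auto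
    show "continuous_on {u..v} S"
      using that by (intro continuous_on_subset[OF Sc]) auto
  qed
  define x where "x = inv_into {a..b} S"
  have inj: "inj_on S {a..b}"
    by (rule inj_onI) (metis atLeastAtMost_iff less_irrefl linorder_neqE_linordered_idom mono)
  have x: "x (S u) = u" if "u \<in> {a..b}" for u
    unfolding x_def using inj that by simp
  have ex: "\<exists>u\<in>{a<..<b}. S u = t" if t: "t \<in> {S a<..<S b}" for t
  proof -
    obtain u where "a \<le> u" "u \<le> b" "S u = t"
      using IVT'[of S a t b] t Sc assms by auto
    then show ?thesis using t by (intro bexI[of _ u]) (auto simp: less_le)
  qed
  show thesis
  proof
    show "open {S a<..<S b}" "is_interval {S a<..<S b}" by auto
    show "0 \<in> {S a<..<S b}" using mono[of a x0] mono[of x0 b] assms by (simp add: S_def)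
    have "S x0 = 0" by (simp add: S_def)
    then show "x 0 = x0" using x[of x0] assms by simp
    fix t assume t: "t \<in> {S a<..<S b}"
    then obtain u where u: "u \<in> {a<..<b}" "S u = t" using ex by blast
    then have xt: "x t = u" using x[of u] by auto
    then show "x t \<in> {a<..<b}" using u by simp
    \<comment> \<open>The inverse function theorem turns S' = h into x' = 1 / h; positivity of
      \<open>h\<close> makes the derivative invertible.\<close>
    have "(x has_derivative (*) (inverse (h u))) (at (S u))"
    proof (rule has_derivative_inverse_strong[where f = S and S = "{a<..<b}"])
      show "(S has_derivative (*) (h u)) (at u)"
        using SD'[OF u(1)] by (simp add: has_field_derivative_def)
      show "(*) (h u) \<circ> (*) (inverse (h u)) = id"
        using pos[of u] u by (auto simp: fun_eq_iff)
    qed (use u x in \<open>auto intro: continuous_on_subset[OF Sc]\<close>)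
    then show "(x has_real_derivative 1 / h (x t)) (at t)"
      using u xt by (simp add: has_field_derivative_def inverse_eq_divide)
  qed
qed

section \<open>Conservation laws and the traces of geodesics\<close>

text \<open>Euler's identity for a function homogeneous of degree one in the velocity. Paired with
  the velocity, the hyperbolic momenta give the norm over \<open>cos y\<close>, and the one-form
  gives the rest.\<close>

lemma randers_euler:
  assumes "cos y \<noteq> 0" and "a \<noteq> 0 \<or> b \<noteq> 0"
  shows "randers x y a b =
    (hyp_momentum y a b a + randers_drift x) * a + (hyp_momentum y a b b + tan y) * b"
proof -
  define n where "n = sqrt (a\<^sup>2 + b\<^sup>2)"
  have "a\<^sup>2 + b\<^sup>2 > 0" using assms(2) by (simp add: sum_power2_gt_zero_iff)
  then have n: "n > 0" "n * n = a * a + b * b" by (simp_all add: n_def power2_eq_square)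
  have "a / (n * cos y) * a + b / (n * cos y) * b = (a * a + b * b) / (n * cos y)"
    by (simp add: add_divide_distrib)
  also have "\<dots> = n / cos y" using n by (simp flip: n(2))
  finally show ?thesis
    using assms(1) unfolding randers_def hyp_momentum_def tan_def n_def[symmetric]
    by (simp add: add_divide_distrib algebra_simps)
qed

lemma band_geodesic_derivatives:
  assumes geo: "finsler_geodesic band F_band I \<omega>" and t: "t \<in> I"
  defines "v \<equiv> \<lambda>t. vector_derivative \<omega> (at t)"
  shows "cos (\<omega> t $ 2) > 0" and "v t $ 1 \<noteq> 0 \<or> v t $ 2 \<noteq> 0"
    and "((\<lambda>s. \<omega> s $ i) has_real_derivative v t $ i) (at t)"
    and "\<exists>d. ((\<lambda>s. v s $ i) has_real_derivative d) (at t)"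
proof -
  have I: "open I" and dw: "\<omega> differentiable at t" and dv: "v differentiable at t"
    and v: "v t \<noteq> 0" and band: "\<omega> t \<in> band"
    using geo t unfolding finsler_geodesic_def v_def
    by (auto simp: differentiable_on_eq_differentiable_at)
  show "cos (\<omega> t $ 2) > 0"
    using band by (intro cos_gt_zero_pi) (auto simp: band_def)
  show "v t $ 1 \<noteq> 0 \<or> v t $ 2 \<noteq> 0" using v by (auto simp: vec_eq_iff forall_2)
  show "((\<lambda>s. \<omega> s $ i) has_real_derivative v t $ i) (at t)"
    using bounded_linear.has_vector_derivative[OF bounded_linear_vec_nth]
      dw unfolding v_def vector_derivative_works has_real_derivative_iff_has_vector_derivative
    by blast
  show "\<exists>d. ((\<lambda>s. v s $ i) has_real_derivative d) (at t)"
    using bounded_linear.has_vector_derivative[OF bounded_linear_vec_nth]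
      dv unfolding vector_derivative_works has_real_derivative_iff_has_vector_derivative
    by blast
qed

text \<open>By Euler's identity, \<open>F\<^sup>2\<close> is the pairing of the energy momenta with the velocity;
  differentiating it along a geodesic gives \<open>F' = 0\<close>. Dividing the momenta by \<open>F\<close> and removing
  the closed form \<open>randers_drift x dx + tan y dy\<close> leaves the equations of the hyperbolic
  band metric.\<close>

lemma band_geodesic_hyp_momentum:
  assumes geo: "finsler_geodesic band F_band I \<omega>" and t: "t \<in> I"
  defines "v \<equiv> \<lambda>t. vector_derivative \<omega> (at t)"
  shows "((\<lambda>s. hyp_momentum (\<omega> s $ 2) (v s $ 1) (v s $ 2) (v s $ 1)) has_real_derivative 0) (at t)"
    and "((\<lambda>s. hyp_momentum (\<omega> s $ 2) (v s $ 1) (v s $ 2) (v s $ 2)) has_real_derivative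
      sqrt ((v t $ 1)\<^sup>2 + (v t $ 2)\<^sup>2) * sin (\<omega> t $ 2) / (cos (\<omega> t $ 2))\<^sup>2) (at t)"
proof -
  have vd: "vector_derivative \<omega> (at s) = v s" for s by (simp add: v_def)
  note d = band_geodesic_derivatives[OF geo, unfolded vd]
  have I: "open I" using geo by (simp add: finsler_geodesic_def)
  have vnz: "v s \<noteq> 0" if "s \<in> I" for s using d(2)[OF that] by auto
  define q1 where "q1 s = hyp_momentum (\<omega> s $ 2) (v s $ 1) (v s $ 2) (v s $ 1)" for s
  define q2 where "q2 s = hyp_momentum (\<omega> s $ 2) (v s $ 1) (v s $ 2) (v s $ 2)" for s
  \<comment> \<open>\<open>e1\<close> and \<open>e2\<close> are the velocity derivatives of the
    metric itself; the momenta of the energy are \<open>f * e1\<close> and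
    \<open>f * e2\<close>.\<close>
  define e1 where "e1 s = q1 s + randers_drift (\<omega> s $ 1)" for s
  define e2 where "e2 s = q2 s + tan (\<omega> s $ 2)" for s
  define f where "f s = F_band (\<omega> s) (v s)" for s
  define fx where "fx = randers_dx (\<omega> t $ 1) (v t $ 1)"
  define fy where "fy = randers_dy (\<omega> t $ 2) (v t $ 1) (v t $ 2)"
  obtain A' B' where A': "((\<lambda>s. v s $ 1) has_real_derivative A') (at t)"
    and B': "((\<lambda>s. v s $ 2) has_real_derivative B') (at t)" using d(4)[OF t] by metis
  have fpos: "f s > 0" if "s \<in> I" for s
    using d(1,2)[OF that] by (simp add: f_def F_band_eq randers_pos)
  have euler: "f s = e1 s * v s $ 1 + e2 s * v s $ 2" if "s \<in> I" for s
    using randers_euler[of "\<omega> s $ 2" "v s $ 1" "v s $ 2" "\<omega> s $ 1"] d(1,2)[OF that]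
    by (simp add: f_def F_band_eq e1_def e2_def q1_def q2_def)
  have P1: "((\<lambda>s. f s * e1 s) has_real_derivative f t * fx) (at t)"
  proof (rule has_field_derivative_transform_within_open[OF _ I t])
    show "((\<lambda>s. partial_vel (finsler_energy F_band) 1 (\<omega> s) (v s)) has_real_derivative f t * fx) (at t)"
      using geo t d(1)[OF t] vnz[OF t] unfolding finsler_geodesic_def vd
      by (auto simp: f_def fx_def band_energy_partials forall_2)
  qed (use d(1) vnz in \<open>force simp: f_def e1_def q1_def band_energy_partials\<close>)
  have P2: "((\<lambda>s. f s * e2 s) has_real_derivative f t * fy) (at t)"
  proof (rule has_field_derivative_transform_within_open[OF _ I t])
    show "((\<lambda>s. partial_vel (finsler_energy F_band) 2 (\<omega> s) (v s)) has_real_derivative f t * fy) (at t)"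
      using geo t d(1)[OF t] vnz[OF t] unfolding finsler_geodesic_def vd
      by (auto simp: f_def fy_def band_energy_partials forall_2)
  qed (use d(1) vnz in \<open>force simp: f_def e2_def q2_def band_energy_partials\<close>)
  define f' where "f' = fx * v t $ 1 + fy * v t $ 2 + e1 t * A' + e2 t * B'"
  have F': "(f has_real_derivative f') (at t)"
    using has_real_derivative_randers[OF d(3)[OF t, of 1] d(3)[OF t, of 2] A' B'] d(1,2)[OF t]
    by (simp add: f_def[abs_def] F_band_eq f'_def fx_def fy_def e1_def e2_def q1_def q2_def)
  have "((\<lambda>s. f s * e1 s * v s $ 1 + f s * e2 s * v s $ 2) has_real_derivative
      (f t * fx * v t $ 1 + A' * (f t * e1 t)) + (f t * fy * v t $ 2 + B' * (f t * e2 t))) (at t)"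
    by (intro DERIV_add DERIV_mult P1 P2 A' B')
  then have "((\<lambda>s. f s * f s) has_real_derivative
      (f t * fx * v t $ 1 + A' * (f t * e1 t)) + (f t * fy * v t $ 2 + B' * (f t * e2 t))) (at t)"
    by (rule has_field_derivative_transform_within_open[OF _ I t])
      (simp add: euler algebra_simps)
  \<comment> \<open>The Euler-Lagrange equations give \<open>f t * f'\<close> as the derivative of
    the squared speed, while the product rule gives twice that.\<close>
  from DERIV_unique[OF DERIV_mult[OF F' F'] this] have "f t * f' = 0"
    by (simp add: f'_def algebra_simps)
  then have f'0: "f' = 0" using fpos[OF t] by simp
  \<comment> \<open>With constant speed, the factor \<open>f\<close> can be divided out of the
    Euler-Lagrange equations.\<close>
  have E: "(e has_real_derivative k) (at t)"
    if "((\<lambda>s. f s * e s) has_real_derivative f t * k) (at t)" for e k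
  proof (rule has_field_derivative_transform_within_open[OF _ I t])
    show "((\<lambda>s. f s * e s / f s) has_real_derivative k) (at t)"
      using DERIV_divide[OF that F'] fpos[OF t] f'0 by simp
  qed (use fpos in force)
  have c: "cos (\<omega> t $ 2) \<noteq> 0" using d(1)[OF t] by simp
  have "((\<lambda>s. e1 s - randers_drift (\<omega> s $ 1)) has_real_derivative 0) (at t)"
    using DERIV_diff[OF E[OF P1] DERIV_chain2[OF has_real_derivative_randers_drift d(3)[OF t, of 1]]]
    by (simp add: fx_def randers_dx_def)
  then show "((\<lambda>s. hyp_momentum (\<omega> s $ 2) (v s $ 1) (v s $ 2) (v s $ 1)) has_real_derivative 0) (at t)"
    by (simp add: e1_def q1_def)
  have "((\<lambda>s. e2 s - tan (\<omega> s $ 2)) has_real_derivative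
      sqrt ((v t $ 1)\<^sup>2 + (v t $ 2)\<^sup>2) * sin (\<omega> t $ 2) / (cos (\<omega> t $ 2))\<^sup>2) (at t)"
    using DERIV_diff[OF E[OF P2] DERIV_chain2[OF DERIV_tan[OF c] d(3)[OF t, of 2]]]
    by (simp add: fy_def randers_dy_def add_divide_distrib divide_inverse algebra_simps)
  then show "((\<lambda>s. hyp_momentum (\<omega> s $ 2) (v s $ 1) (v s $ 2) (v s $ 2)) has_real_derivative
      sqrt ((v t $ 1)\<^sup>2 + (v t $ 2)\<^sup>2) * sin (\<omega> t $ 2) / (cos (\<omega> t $ 2))\<^sup>2) (at t)"
    by (simp add: e2_def q2_def)
qed

text \<open>As a function of x, g = sin y satisfies g'' = g, with \<open>r\<close> below playing the
  role of g'. The quantities exp (-x) (g + g') and exp x (g - g') are its two first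
  integrals.\<close>

lemma band_geodesic_curve:
  assumes geo: "finsler_geodesic band F_band I \<omega>" and nonvert: "\<not> (\<exists>a. \<forall>t\<in>I. \<omega> t $ 1 = a)"
  obtains P Q where
    "\<And>t. t \<in> I \<Longrightarrow> exp (\<omega> t $ 1) * sin (\<omega> t $ 2) = P * exp (2 * \<omega> t $ 1) + Q"
proof -
  define v where "v = (\<lambda>t. vector_derivative \<omega> (at t))"
  have vd: "vector_derivative \<omega> (at s) = v s" for s by (simp add: v_def)
  note d = band_geodesic_derivatives[OF geo, unfolded vd]
  note h = band_geodesic_hyp_momentum[OF geo, unfolded vd]
  have I: "convex I"
    using geo by (simp add: finsler_geodesic_def is_interval_convex_1)
  note const = has_field_derivative_zero_constant[OF I, OF has_field_derivative_at_within]
  define n where "n s = sqrt ((v s $ 1)\<^sup>2 + (v s $ 2)\<^sup>2)" for s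
  define q2 where "q2 s = hyp_momentum (\<omega> s $ 2) (v s $ 1) (v s $ 2) (v s $ 2)" for s
  have n: "n s > 0" "n s * n s = v s $ 1 * v s $ 1 + v s $ 2 * v s $ 2" if "s \<in> I" for s
    using d(2)[OF that] by (auto simp: n_def sum_power2_gt_zero_iff power2_eq_square[symmetric])
  obtain p where "\<And>s. s \<in> I \<Longrightarrow> hyp_momentum (\<omega> s $ 2) (v s $ 1) (v s $ 2) (v s $ 1) = p"
    using const[OF h(1)] by blast
  then have p: "p * (n s * cos (\<omega> s $ 2)) = v s $ 1" if "s \<in> I" for s
    using that n(1)[OF that] d(1)[OF that] unfolding hyp_momentum_def n_def by force
  have q2: "q2 s * (n s * cos (\<omega> s $ 2)) = v s $ 2" if "s \<in> I" for s
    using that n(1)[OF that] d(1)[OF that] unfolding hyp_momentum_def n_def q2_def by force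
  \<comment> \<open>Zero horizontal momentum would make the first coordinate constant, which
    \<open>nonvert\<close> excludes.\<close>
  have p0: "p \<noteq> 0"
  proof
    assume "p = 0"
    then have "((\<lambda>s. \<omega> s $ 1) has_real_derivative 0) (at s)" if "s \<in> I" for s
      using d(3)[OF that, of 1] p[OF that] by simp
    from const[OF this] nonvert show False by blast
  qed
  define r where "r s = cos (\<omega> s $ 2) * q2 s / p" for s
  have ar: "v s $ 1 * r s = v s $ 2 * cos (\<omega> s $ 2)" if "s \<in> I" for s
    unfolding p[OF that, symmetric] q2[OF that, symmetric] r_def using p0 by simp
  have r': "(r has_real_derivative v s $ 1 * sin (\<omega> s $ 2)) (at s)" if s: "s \<in> I" for s
  proof -
    let ?c = "cos (\<omega> s $ 2)" and ?s = "sin (\<omega> s $ 2)"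
    have "(r has_real_derivative ((- ?s * v s $ 2) * q2 s + n s * ?s / ?c\<^sup>2 * ?c) / p) (at s)"
      unfolding r_def
      by (intro DERIV_cdivide DERIV_mult DERIV_chain2[OF DERIV_cos d(3)] s
          h(2)[OF s, folded n_def q2_def])
    moreover have "((- ?s * v s $ 2) * q2 s + n s * ?s / ?c\<^sup>2 * ?c) / p = v s $ 1 * ?s"
    proof -
      have cn: "?c > 0" "n s > 0" using d(1)[OF s] n(1)[OF s] by auto
      \<comment> \<open>Multiplying by the positive \<open>n s * ?c\<close> turns momenta into
        velocities; then the squared norm minus the squared second velocity leaves the squared
        first.\<close>
      have "((- ?s * v s $ 2) * q2 s + n s * ?s / ?c\<^sup>2 * ?c) * (n s * ?c)
          = ?s * (n s * n s - v s $ 2 * (q2 s * (n s * ?c)))"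
        using cn by (simp add: power2_eq_square algebra_simps)
      also have "\<dots> = ?s * (v s $ 1 * v s $ 1)"
        unfolding q2[OF s] n(2)[OF s] by simp
      also have "\<dots> = ?s * v s $ 1 * p * (n s * ?c)"
        by (simp add: p[OF s, symmetric])
      finally have "(- ?s * v s $ 2) * q2 s + n s * ?s / ?c\<^sup>2 * ?c = ?s * v s $ 1 * p"
        using cn by simp
      then show ?thesis using p0 by simp
    qed
    ultimately show ?thesis by simp
  qed
  have "((\<lambda>s. exp (- \<omega> s $ 1) * (sin (\<omega> s $ 2) + r s)) has_real_derivative 0) (at s)"
    if s: "s \<in> I" for s
    by (rule derivative_eq_intros d(3) s r' refl)+ (use ar[OF s] in \<open>simp add: algebra_simps\<close>)
  from const[OF this] obtain P where P: "\<And>s. s \<in> I \<Longrightarrow> exp (- \<omega> s $ 1) * (sin (\<omega> s $ 2) + r s) = P"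
    by blast
  have "((\<lambda>s. exp (\<omega> s $ 1) * (sin (\<omega> s $ 2) - r s)) has_real_derivative 0) (at s)"
    if s: "s \<in> I" for s
    by (rule derivative_eq_intros d(3) s r' refl)+ (use ar[OF s] in \<open>simp add: algebra_simps\<close>)
  from const[OF this] obtain Q where Q: "\<And>s. s \<in> I \<Longrightarrow> exp (\<omega> s $ 1) * (sin (\<omega> s $ 2) - r s) = Q"
    by blast
  show thesis
  proof
    fix t assume t: "t \<in> I"
    \<comment> \<open>Adding exp (2x) times the first integral to the second cancels
      \<open>r\<close> and leaves 2 exp x sin y, whence the halves.\<close>
    have "exp (2 * \<omega> t $ 1) = exp (\<omega> t $ 1) * exp (\<omega> t $ 1)"
      by (simp flip: exp_add)
    then show "exp (\<omega> t $ 1) * sin (\<omega> t $ 2) = P / 2 * exp (2 * \<omega> t $ 1) + Q / 2"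
      unfolding P[OF t, symmetric] Q[OF t, symmetric] by (simp add: exp_minus field_simps)
  qed
qed

section \<open>Construction of geodesics with a prescribed trace\<close>

lemma has_vector_derivative_vector_2:
  assumes "(X has_real_derivative a) (at t)" and "(Y has_real_derivative b) (at t)"
  shows "((\<lambda>s. vector [X s, Y s] :: real ^ 2) has_vector_derivative vector [a, b]) (at t)"
proof -
  have eq: "(vector [x, y] :: real ^ 2) = x *\<^sub>R axis 1 1 + y *\<^sub>R axis 2 1" for x y
    by (simp add: vec_eq_iff forall_2)
  show ?thesis
    unfolding eq using assms by (auto intro!: derivative_eq_intros)
qed

text \<open>At unit Finsler speed the momenta of the energy are those of the metric. Adding the
  closed one-form back to the hyperbolic equations \<open>q1\<close> and \<open>q2\<close> therefore
  yields the Euler-Lagrange equations.\<close>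

lemma band_geodesicI:
  assumes J: "open J" "is_interval J" "J \<noteq> {}"
    and Y: "\<And>t. t \<in> J \<Longrightarrow> - (pi / 2) < Y t \<and> Y t < pi / 2"
    and X': "\<And>t. t \<in> J \<Longrightarrow> (X has_real_derivative A t) (at t)"
    and Y': "\<And>t. t \<in> J \<Longrightarrow> (Y has_real_derivative B t) (at t)"
    and A': "\<And>t. t \<in> J \<Longrightarrow> \<exists>d. (A has_real_derivative d) (at t)"
    and B': "\<And>t. t \<in> J \<Longrightarrow> \<exists>d. (B has_real_derivative d) (at t)"
    and nz: "\<And>t. t \<in> J \<Longrightarrow> A t \<noteq> 0 \<or> B t \<noteq> 0"
    and unit: "\<And>t. t \<in> J \<Longrightarrow> randers (X t) (Y t) (A t) (B t) = 1"
    and q1: "\<And>t. t \<in> J \<Longrightarrow>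
      ((\<lambda>s. hyp_momentum (Y s) (A s) (B s) (A s)) has_real_derivative 0) (at t)"
    and q2: "\<And>t. t \<in> J \<Longrightarrow>
      ((\<lambda>s. hyp_momentum (Y s) (A s) (B s) (B s)) has_real_derivative
        sqrt ((A t)\<^sup>2 + (B t)\<^sup>2) * sin (Y t) / (cos (Y t))\<^sup>2) (at t)"
  shows "finsler_geodesic band F_band J (\<lambda>t. vector [X t, Y t])"
proof -
  define \<omega> where "\<omega> t = (vector [X t, Y t] :: real ^ 2)" for t
  define v where "v t = (vector [A t, B t] :: real ^ 2)" for t
  have c: "cos (Y t) > 0" if "t \<in> J" for t using Y[OF that] by (intro cos_gt_zero_pi) auto
  have w: "(\<omega> has_vector_derivative v t) (at t)" if "t \<in> J" for t
    unfolding \<omega>_def[abs_def] v_def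
    by (rule has_vector_derivative_vector_2[OF X'[OF that] Y'[OF that]])
  have vd: "vector_derivative \<omega> (at t) = v t" if "t \<in> J" for t
    by (rule vector_derivative_at[OF w[OF that]])
  have v0: "v t \<noteq> 0" if "t \<in> J" for t
    using nz[OF that] by (auto simp: v_def vec_eq_iff forall_2)
  have F1: "F_band (\<omega> t) (v t) = 1" if "t \<in> J" for t
    using unit[OF that] by (simp add: F_band_eq \<omega>_def v_def)
  have vdiff: "(\<lambda>s. vector_derivative \<omega> (at s)) differentiable (at t)" if t: "t \<in> J" for t
  proof -
    obtain a b where "(A has_real_derivative a) (at t)" "(B has_real_derivative b) (at t)"
      using A'[OF t] B'[OF t] by blast
    then have "(v has_vector_derivative vector [a, b]) (at t)"
      unfolding v_def[abs_def] by (rule has_vector_derivative_vector_2)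
    then have "((\<lambda>s. vector_derivative \<omega> (at s)) has_vector_derivative vector [a, b]) (at t)"
      by (rule has_vector_derivative_transform_within_open[OF _ J(1) t]) (simp add: vd)
    then show ?thesis by (rule differentiableI_vector)
  qed
  have EL: "((\<lambda>s. partial_vel (finsler_energy F_band) i (\<omega> s) (vector_derivative \<omega> (at s)))
      has_real_derivative partial_pos (finsler_energy F_band) i (\<omega> t) (v t)) (at t)"
    if t: "t \<in> J" for t i
  proof -
    have "i = 1 \<or> i = 2" using forall_2[of "\<lambda>i. i = 1 \<or> i = 2"] by auto
    then show ?thesis
    proof
      assume [simp]: "i = 1"
      have "((\<lambda>s. hyp_momentum (Y s) (A s) (B s) (A s) + randers_drift (X s))
          has_real_derivative partial_pos (finsler_energy F_band) i (\<omega> t) (v t)) (at t)"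
        using DERIV_add[OF q1[OF t] DERIV_chain2[OF has_real_derivative_randers_drift X'[OF t]]]
          c[OF t] v0[OF t] F1[OF t]
        by (simp add: band_energy_partials \<omega>_def v_def randers_dx_def)
      then show ?thesis
        by (rule has_field_derivative_transform_within_open[OF _ J(1) t])
          (use c v0 F1 in \<open>force simp: vd band_energy_partials \<omega>_def v_def\<close>)
    next
      assume [simp]: "i = 2"
      have cnz: "cos (Y t) \<noteq> 0" using c[OF t] by simp
      have "((\<lambda>s. hyp_momentum (Y s) (A s) (B s) (B s) + tan (Y s))
          has_real_derivative partial_pos (finsler_energy F_band) i (\<omega> t) (v t)) (at t)"
        using DERIV_add[OF q2[OF t] DERIV_chain2[OF DERIV_tan[OF cnz] Y'[OF t]]]
          cnz v0[OF t] F1[OF t]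
        by (simp add: band_energy_partials \<omega>_def v_def randers_dy_def add_divide_distrib
            divide_inverse algebra_simps)
      then show ?thesis
        by (rule has_field_derivative_transform_within_open[OF _ J(1) t])
          (use c v0 F1 in \<open>force simp: vd band_energy_partials \<omega>_def v_def\<close>)
    qed
  qed
  have "finsler_geodesic band F_band J \<omega>"
    unfolding finsler_geodesic_def differentiable_on_eq_differentiable_at[OF J(1)]
    using J Y w v0 vdiff EL
    by (auto simp: vd band_def \<omega>_def intro: differentiableI_vector)
  then show ?thesis by (simp add: \<omega>_def[abs_def])
qed

text \<open>The curve \<open>sin y = g x = P exp x + Q exp (- x)\<close> is a graph over \<open>x\<close> with slope \<open>w = g' x / cos y\<close>;
  parametrising it by Finsler arc length means solving the autonomous equation \<open>x' = 1 / h x\<close>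
  with \<open>h\<close> the Finsler length of the tangent vector \<open>(1, w)\<close>.\<close>

lemma band_geodesic_exists:
  fixes P Q x0 y0 :: real
  assumes y0: "- (pi / 2) < y0" "y0 < pi / 2"
    and on: "exp x0 * sin y0 = P * exp (2 * x0) + Q"
  obtains J \<omega> where "finsler_geodesic band F_band J \<omega>" "0 \<in> J" "\<omega> 0 = vector [x0, y0]"
    "\<And>t. t \<in> J \<Longrightarrow> exp (\<omega> t $ 1) * sin (\<omega> t $ 2) = P * exp (2 * \<omega> t $ 1) + Q"
proof -
  define g where "g x = P * exp x + Q * exp (- x)" for x
  define g' where "g' x = P * exp x - Q * exp (- x)" for x
  define c where "c x = sqrt (1 - (g x)\<^sup>2)" for x
  define w where "w x = g' x / c x" for x
  define h where "h x = randers x (arcsin (g x)) 1 (w x)" for x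
  \<comment> \<open>Along the curve g'^2 + cos^2 y has the constant value 1 - 4PQ;
    \<open>1 / D\<close> will be the conserved horizontal momentum.\<close>
  define D where "D = sqrt (1 - 4 * P * Q)"
  have g_exp: "exp x * g x = P * exp (2 * x) + Q" for x
  proof -
    have "exp (2 * x) = exp x * exp x" by (simp flip: exp_add)
    then show ?thesis by (simp add: g_def exp_minus field_simps)
  qed
  have gg: "(g x)\<^sup>2 - (g' x)\<^sup>2 = 4 * P * Q" for x
    by (simp add: g_def g'_def power2_eq_square exp_minus field_simps)
  have dg: "(g has_real_derivative g' x) (at x)" for x
    unfolding g_def g'_def by (rule derivative_eq_intros refl)+ simp
  have dg': "(g' has_real_derivative g x) (at x)" for x
    unfolding g_def g'_def by (rule derivative_eq_intros refl)+ simp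
  have gx0: "g x0 = sin y0"
    using g_exp[of x0] on by (metis exp_not_eq_zero mult_cancel_left)
  have "cos y0 > 0" using y0 by (intro cos_gt_zero_pi) auto
  then have g1: "(g x0)\<^sup>2 < 1"
    by (simp add: gx0 sin_squared_eq)
  \<comment> \<open>By continuity g^2 stays below 1 near \<open>x0\<close>, which keeps
    \<open>arcsin (g x)\<close> strictly inside the band and differentiable. Taking half of \<delta>
    gives a closed interval with this property.\<close>
  have "isCont (\<lambda>x. (g x)\<^sup>2) x0"
    using DERIV_isCont[OF dg] by (intro continuous_intros) auto
  then obtain \<delta> where \<delta>: "\<delta> > 0" "\<And>x. \<bar>x - x0\<bar> < \<delta> \<Longrightarrow> \<bar>(g x)\<^sup>2 - (g x0)\<^sup>2\<bar> < 1 - (g x0)\<^sup>2"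
    using g1 unfolding continuous_at_eps_delta dist_real_def by (metis diff_gt_0_iff_gt)
  define a b where "a = x0 - \<delta> / 2" and "b = x0 + \<delta> / 2"
  have sm: "(g x)\<^sup>2 < 1" if "x \<in> {a..b}" for x
  proof -
    have "\<bar>x - x0\<bar> < \<delta>" using that \<delta>(1) unfolding a_def b_def atLeastAtMost_iff by arith
    from \<delta>(2)[OF this] show ?thesis by arith
  qed
  have c: "c x > 0" "c x * c x = 1 - (g x)\<^sup>2" if "x \<in> {a..b}" for x
    using sm[OF that] by (auto simp: c_def)
  have gb: "- 1 < g x" "g x < 1" if "x \<in> {a..b}" for x
    using sm[OF that] by (auto simp: abs_square_less_1 abs_less_iff)
  have cos: "cos (arcsin (g x)) = c x" if "x \<in> {a..b}" for x
    using gb[OF that] by (simp add: cos_arcsin c_def)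
  have dc: "(c has_real_derivative - (g x * w x)) (at x)" if "x \<in> {a..b}" for x
  proof -
    have pos: "1 - (g x)\<^sup>2 > 0" using sm[OF that] by simp
    have "((\<lambda>x. 1 - (g x)\<^sup>2) has_real_derivative - (2 * g x * g' x)) (at x)"
      by (rule derivative_eq_intros dg refl)+ simp
    from DERIV_chain2[OF DERIV_real_sqrt[OF pos] this] show ?thesis
      unfolding c_def w_def by (rule DERIV_cong) (simp add: inverse_eq_divide)
  qed
  have DD: "(g' x)\<^sup>2 + c x * c x = D\<^sup>2" "D > 0" if "x \<in> {a..b}" for x
  proof -
    have "1 - 4 * P * Q > 0" using gg[of x] sm[OF that] zero_le_power2[of "g' x"] by linarith
    then show "D > 0" "(g' x)\<^sup>2 + c x * c x = D\<^sup>2"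
      using c(2)[OF that] gg[of x] by (simp_all add: D_def)
  qed
  have dw: "(w has_real_derivative g x * D\<^sup>2 / (c x) ^ 3) (at x)" if "x \<in> {a..b}" for x
  proof -
    have "(w has_real_derivative (g x * c x - g' x * (- (g x * w x))) / (c x * c x)) (at x)"
      unfolding w_def using c(1)[OF that] dc[OF that, unfolded w_def]
      by (intro DERIV_divide dg') auto
    moreover have "(g x * c x - g' x * (- (g x * w x))) / (c x * c x) = g x * D\<^sup>2 / (c x) ^ 3"
      unfolding DD(1)[OF that, symmetric] w_def using c(1)[OF that]
      by (simp add: field_simps power2_eq_square power3_eq_cube)
    ultimately show ?thesis by simp
  qed
  have dy: "((\<lambda>x. arcsin (g x)) has_real_derivative w x) (at x)" if "x \<in> {a..b}" for x
    using DERIV_chain2[OF DERIV_arcsin[OF gb[OF that]] dg]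
    by (simp add: w_def c_def field_simps)
  have dh: "\<exists>d. (h has_real_derivative d) (at x)" if "x \<in> {a..b}" for x
    unfolding h_def
    using has_real_derivative_randers[OF DERIV_ident dy[OF that] DERIV_const dw[OF that]]
      cos[OF that] c(1)[OF that] by fastforce
  have hpos: "h x > 0" if "x \<in> {a..b}" for x
    using cos[OF that] c(1)[OF that] by (simp add: h_def randers_pos)
  have "continuous_on {a..b} h"
    using dh DERIV_isCont by (blast intro: continuous_at_imp_continuous_on)
  moreover have "a < x0" "x0 < b" using \<delta>(1) by (auto simp: a_def b_def)
  ultimately obtain J X where J: "open J" "is_interval J" "0 \<in> J" and X0: "X 0 = x0"
    and X: "\<And>t. t \<in> J \<Longrightarrow> X t \<in> {a<..<b}"
    and X': "\<And>t. t \<in> J \<Longrightarrow> (X has_real_derivative 1 / h (X t)) (at t)"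
    using autonomous_ode_local_solution[of a x0 b h] hpos by metis
  have Xab: "X t \<in> {a..b}" if "t \<in> J" for t using X[OF that] by auto
  define Y where "Y t = arcsin (g (X t))" for t
  define A where "A t = 1 / h (X t)" for t
  define B where "B t = A t * w (X t)" for t
  have A: "A t > 0" if "t \<in> J" for t using hpos[OF Xab[OF that]] by (simp add: A_def)
  have cosY: "cos (Y t) = c (X t)" if "t \<in> J" for t
    using cos[OF Xab[OF that]] by (simp add: Y_def)
  have sinY: "sin (Y t) = g (X t)" if "t \<in> J" for t
    using gb[OF Xab[OF that]] by (simp add: Y_def)
  \<comment> \<open>The velocity is \<open>A t\<close> times (1, w), and 1 + w^2 = (c^2 + g'^2) /
    c^2 = D^2 / c^2.\<close>
  have nc: "sqrt ((A t)\<^sup>2 + (B t)\<^sup>2) = A t * D / c (X t)" if t: "t \<in> J" for t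
  proof (rule real_sqrt_unique)
    note f = c(1)[OF Xab[OF t]] A[OF t] DD[OF Xab[OF t]]
    show "(A t * D / c (X t))\<^sup>2 = (A t)\<^sup>2 + (B t)\<^sup>2"
      unfolding power_mult_distrib power_divide f(3)[symmetric] B_def w_def
      using f(1) by (simp add: field_simps power2_eq_square)
    show "0 \<le> A t * D / c (X t)" using f by simp
  qed
  have dA: "\<exists>d. (A has_real_derivative d) (at t)" if t: "t \<in> J" for t
  proof -
    obtain d where d: "(h has_real_derivative d) (at (X t))" using dh[OF Xab[OF t]] by blast
    from DERIV_divide[OF DERIV_const[of 1] DERIV_chain2[OF d X'[OF t]]] hpos[OF Xab[OF t]]
    show ?thesis by (auto simp: A_def[abs_def])
  qed
  have dwX: "((\<lambda>s. w (X s)) has_real_derivative g (X t) * D\<^sup>2 / (c (X t)) ^ 3 * A t) (at t)"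
    if t: "t \<in> J" for t
    using DERIV_chain2[OF dw[OF Xab[OF t]] X'[OF t]] by (simp add: A_def)
  have q1: "1 / D = hyp_momentum (Y s) (A s) (B s) (A s)" if "s \<in> J" for s
    unfolding hyp_momentum_def nc[OF that] cosY[OF that]
    using A[OF that] c(1)[OF Xab[OF that]] by simp
  have q2: "w (X s) / D = hyp_momentum (Y s) (A s) (B s) (B s)" if "s \<in> J" for s
    unfolding hyp_momentum_def nc[OF that] cosY[OF that] unfolding B_def
    using A[OF that] c(1)[OF Xab[OF that]] by simp
  have "finsler_geodesic band F_band J (\<lambda>t. vector [X t, Y t])"
  proof (rule band_geodesicI)
    fix t assume t: "t \<in> J"
    show "- (pi / 2) < Y t \<and> Y t < pi / 2"
      unfolding Y_def using arcsin_lt_bounded[OF gb[OF Xab[OF t]]] by simp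
    show "(X has_real_derivative A t) (at t)" using X'[OF t] by (simp add: A_def)
    show "(Y has_real_derivative B t) (at t)"
      unfolding Y_def[abs_def] using DERIV_chain2[OF dy[OF Xab[OF t]] X'[OF t]]
      by (simp add: A_def B_def)
    show "\<exists>d. (A has_real_derivative d) (at t)" by (rule dA[OF t])
    then show "\<exists>d. (B has_real_derivative d) (at t)"
      unfolding B_def[abs_def] using DERIV_mult dwX[OF t] by blast
    show "A t \<noteq> 0 \<or> B t \<noteq> 0" using A[OF t] by simp
    \<comment> \<open>By homogeneity the length is \<open>A t\<close> times \<open>h (X t)\<close>,
      and \<open>A t\<close> was chosen as the reciprocal.\<close>
    show "randers (X t) (Y t) (A t) (B t) = 1"
      using randers_scale[OF A[OF t], of "X t" "Y t" 1 "w (X t)"] hpos[OF Xab[OF t]]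
      by (simp add: B_def Y_def flip: h_def) (simp add: A_def)
    show "((\<lambda>s. hyp_momentum (Y s) (A s) (B s) (A s)) has_real_derivative 0) (at t)"
      by (rule has_field_derivative_transform_within_open[OF DERIV_const J(1) t q1])
    show "((\<lambda>s. hyp_momentum (Y s) (A s) (B s) (B s)) has_real_derivative
        sqrt ((A t)\<^sup>2 + (B t)\<^sup>2) * sin (Y t) / (cos (Y t))\<^sup>2) (at t)"
    proof (rule has_field_derivative_transform_within_open[OF _ J(1) t q2])
      show "((\<lambda>s. w (X s) / D) has_real_derivative
          sqrt ((A t)\<^sup>2 + (B t)\<^sup>2) * sin (Y t) / (cos (Y t))\<^sup>2) (at t)"
        unfolding nc[OF t] cosY[OF t] sinY[OF t]
        by (rule DERIV_cong[OF DERIV_cdivide[OF dwX[OF t]]])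
          (use DD(2)[OF Xab[OF t]] in \<open>simp add: field_simps power2_eq_square power3_eq_cube\<close>)
    qed
  qed (use J in auto)
  then show thesis
  proof
    show "0 \<in> J" by (rule J)
    show "vector [X 0, Y 0] = (vector [x0, y0] :: real ^ 2)"
      using y0 by (simp add: Y_def X0 gx0 arcsin_sin)
    show "exp ((vector [X t, Y t] :: real ^ 2) $ 1) * sin ((vector [X t, Y t] :: real ^ 2) $ 2)
        = P * exp (2 * (vector [X t, Y t] :: real ^ 2) $ 1) + Q" if "t \<in> J" for t
      using g_exp[of "X t"] sinY[OF that] by simp
  qed
qed

section \<open>Translation between the exponential form and the parameters m, c and sign\<close>

theorem theorem4p3:
  "(\<forall>(I :: real set) (\<omega> :: real \<Rightarrow> real ^ 2).
      finsler_geodesic band F_band I \<omega> \<and> \<not> (\<exists>a. \<forall>t\<in>I. \<omega> t $ 1 = a) \<longrightarrow>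
      (\<exists>(m :: real) (c :: real). \<exists>\<sigma> \<in> {1, -1 :: real}. \<forall>t\<in>I.
         4 * exp (\<omega> t $ 1) * sin (\<omega> t $ 2) =
         \<sigma> * (m * (4 - exp (2 * \<omega> t $ 1)) + c * (4 + exp (2 * \<omega> t $ 1))))) \<and>
   (\<forall>(m :: real) (c :: real). \<forall>\<sigma> \<in> {1, -1 :: real}. \<forall>p\<in>band.
      4 * exp (p $ 1) * sin (p $ 2) =
      \<sigma> * (m * (4 - exp (2 * p $ 1)) + c * (4 + exp (2 * p $ 1))) \<longrightarrow>
      (\<exists>(I :: real set) (\<omega> :: real \<Rightarrow> real ^ 2).
         finsler_geodesic band F_band I \<omega> \<and> 0 \<in> I \<and> \<omega> 0 = p \<and>
         (\<forall>t\<in>I.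
            4 * exp (\<omega> t $ 1) * sin (\<omega> t $ 2) =
            \<sigma> * (m * (4 - exp (2 * \<omega> t $ 1)) + c * (4 + exp (2 * \<omega> t $ 1))))))"
proof (intro conjI allI impI ballI)
  fix I :: "real set" and \<omega> :: "real \<Rightarrow> real ^ 2"
  assume "finsler_geodesic band F_band I \<omega> \<and> \<not> (\<exists>a. \<forall>t\<in>I. \<omega> t $ 1 = a)"
  then obtain P Q where
    PQ: "\<And>t. t \<in> I \<Longrightarrow> exp (\<omega> t $ 1) * sin (\<omega> t $ 2) = P * exp (2 * \<omega> t $ 1) + Q"
    using band_geodesic_curve by blast
  \<comment> \<open>Comparing coefficients in 4 (P u + Q) = m (4 - u) + c (4 + u) gives m + c = Q
    and c - m = 4 P; the sign is absorbed into m and c.\<close>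
  have "4 * exp (\<omega> t $ 1) * sin (\<omega> t $ 2) =
      1 * ((Q - 4 * P) / 2 * (4 - exp (2 * \<omega> t $ 1)) + (Q + 4 * P) / 2 * (4 + exp (2 * \<omega> t $ 1)))"
    if "t \<in> I" for t
    using PQ[OF that] by (simp add: field_simps)
  then show "\<exists>m c. \<exists>\<sigma> \<in> {1, -1 :: real}. \<forall>t\<in>I. 4 * exp (\<omega> t $ 1) * sin (\<omega> t $ 2) =
      \<sigma> * (m * (4 - exp (2 * \<omega> t $ 1)) + c * (4 + exp (2 * \<omega> t $ 1)))"
    by blast
next
  fix m c \<sigma> :: real and p :: "real ^ 2"
  assume p: "p \<in> band"
    and on: "4 * exp (p $ 1) * sin (p $ 2) =
      \<sigma> * (m * (4 - exp (2 * p $ 1)) + c * (4 + exp (2 * p $ 1)))"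
  \<comment> \<open>The same comparison read backwards, with the sign kept in both
    coefficients.\<close>
  have eq: "4 * e * s = \<sigma> * (m * (4 - u) + c * (4 + u)) \<longleftrightarrow>
      e * s = \<sigma> * (c - m) / 4 * u + \<sigma> * (c + m)" for e s u
    by (auto simp: field_simps)
  obtain J \<omega> where "finsler_geodesic band F_band J \<omega>" "0 \<in> J" "\<omega> 0 = vector [p $ 1, p $ 2]"
    "\<And>t. t \<in> J \<Longrightarrow> exp (\<omega> t $ 1) * sin (\<omega> t $ 2)
      = \<sigma> * (c - m) / 4 * exp (2 * \<omega> t $ 1) + \<sigma> * (c + m)"
    using band_geodesic_exists[of "p $ 2" "p $ 1" "\<sigma> * (c - m) / 4" "\<sigma> * (c + m)"] p on
    unfolding eq band_def by blast
  moreover have "vector [p $ 1, p $ 2] = p" by (simp add: vec_eq_iff forall_2)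
  ultimately show "\<exists>I \<omega>. finsler_geodesic band F_band I \<omega> \<and> 0 \<in> I \<and> \<omega> 0 = p \<and>
      (\<forall>t\<in>I. 4 * exp (\<omega> t $ 1) * sin (\<omega> t $ 2) =
        \<sigma> * (m * (4 - exp (2 * \<omega> t $ 1)) + c * (4 + exp (2 * \<omega> t $ 1))))"
    unfolding eq by auto
qed

end
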